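(* Let $(X,\mathcal B)$ be an uncountable standard Borel space. (1) The sets $\mathcal Per$ and $\mathcal Per_0$ are dense in $(Aut(X,\mathcal B),\tau)$. Moreover, $\mathcal Per$ is also dense in $Aut(X,\mathcal B)$ with respect to the topologies $\tau''$ and $\overline p$. (2) For each aperiodic $T\in Aut(X,\mathcal B)$, the set $\mathcal Per\cap[T]$ is $\tau$-dense in $[T]$. (3) The set $\mathcal Per$ is not dense in $Aut(X,\mathcal B)$ with respect to $p$.
   Context: $Aut(X,\mathcal B)$ is the group of all one-to-one Borel automorphisms of $X$. $\mathcal Per$ is the set of pointwise periodic automorphisms: for every $x\in X$ there is $n=n(x)\ge1$ with $T^nx=x$. $\mathcal Per_0$ is the set of $P\in Aut(X,\mathcal B)$ for which there is $N\ge 1$ with $P^Nx=x$ for all $x\in X$. $T$ is aperiodic if all its orbits are infinite. $[T]=\{\gamma\in Aut(X,\mathcal B):\gamma x\in\{T^nx:n\in\mathbb Z\}\ \forall x\in X\}$ is the full group of $T$. $\mathcal M_1(X)$ is the set of Borel probability measures on $X$; $B(X)_1$ is the set of Borel functions $f:X\to\mathbb R$ with $\sup|f|\le1$; $E(S,T)=\{x: Tx\ne Sx\}\cup\{x: T^{-1}x\ne S^{-1}x\}$; $\mu\circ S(f)=\int_X f(S^{-1}x)\,d\mu(x)$. The topologies have the following bases of neighborhoods ($T\in Aut(X,\mathcal B)$, $\mu_j\in\mathcal M_1(X)$, $F_i\in\mathcal B$, $\varepsilon>0$, finite families): $\tau$: $\{S:\mu_j(E(S,T))<\varepsilon,\ j=1,\dots,n\}$;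 $\tau''$: $\{S:\sup_{f\in B(X)_1}|\mu_j\circ S(f)-\mu_j\circ T(f)|<\varepsilon,\ j=1,\dots,n\}$; $p$: $\{S: SF_i=TF_i,\ i=1,\dots,k\}$; $\overline p$: $\{S:\mu_j(SF_i\,\Delta\, TF_i)+\mu_j(S^{-1}F_i\,\Delta\, T^{-1}F_i)<\varepsilon,\ i\le k,\ j\le n\}$. *)

theory Defs
  imports "HOL-Probability.Probability" "HOL-Combinatorics.Permutations"
begin

text \<open>
  A Borel space is represented by a measure \<open>M\<close> of which only \<open>space M\<close> and \<open>sets M\<close> matter.
  It is standard if its sigma-algebra is generated by a Polish topology.
\<close>

definition standard_borel :: "'a measure \<Rightarrow> bool" where
  "standard_borel M \<longleftrightarrow>
     (\<exists>X. completely_metrizable_space X \<and> separable_space X \<and> topspace X = space M \<and>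
          sets M = sigma_sets (topspace X) {U. openin X U})"

text \<open>
  Automorphisms are extended by the identity outside \<open>space M\<close>, so that equality of functions
  is equality on \<open>space M\<close>, and \<open>inv\<close>, \<open>(\<circ>)\<close> and \<open>(^^)\<close> are the group operations.
\<close>

definition Borel_aut :: "'a measure \<Rightarrow> ('a \<Rightarrow> 'a) set" where
  "Borel_aut M =
     {T. T permutes space M \<and> T \<in> measurable M M \<and> inv T \<in> measurable M M}"

definition Per :: "'a measure \<Rightarrow> ('a \<Rightarrow> 'a) set" where
  "Per M = {P \<in> Borel_aut M. \<forall>x\<in>space M. \<exists>n\<ge>1. (P ^^ n) x = x}"

definition Per0 :: "'a measure \<Rightarrow> ('a \<Rightarrow> 'a) set" where
  "Per0 M = {P \<in> Borel_aut M. \<exists>N\<ge>1. \<forall>x\<in>space M. (P ^^ N) x = x}"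

definition int_iter :: "('a \<Rightarrow> 'a) \<Rightarrow> int \<Rightarrow> 'a \<Rightarrow> 'a" where
  "int_iter T n = (if 0 \<le> n then T ^^ nat n else inv T ^^ nat (- n))"

definition int_orbit :: "('a \<Rightarrow> 'a) \<Rightarrow> 'a \<Rightarrow> 'a set" where
  "int_orbit T x = {int_iter T n x | n. True}"

definition aperiodic :: "'a measure \<Rightarrow> ('a \<Rightarrow> 'a) \<Rightarrow> bool" where
  "aperiodic M T \<longleftrightarrow> (\<forall>x\<in>space M. infinite (int_orbit T x))"

definition full_group :: "'a measure \<Rightarrow> ('a \<Rightarrow> 'a) \<Rightarrow> ('a \<Rightarrow> 'a) set" where
  "full_group M T = {\<gamma> \<in> Borel_aut M. \<forall>x\<in>space M. \<gamma> x \<in> int_orbit T x}"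

definition Borel_probs :: "'a measure \<Rightarrow> 'a measure set" where
  "Borel_probs M = {\<mu>. sets \<mu> = sets M \<and> prob_space \<mu>}"

definition Borel_unit_ball :: "'a measure \<Rightarrow> ('a \<Rightarrow> real) set" where
  "Borel_unit_ball M = {f \<in> borel_measurable M. \<forall>x\<in>space M. \<bar>f x\<bar> \<le> 1}"

definition diff_set :: "'a measure \<Rightarrow> ('a \<Rightarrow> 'a) \<Rightarrow> ('a \<Rightarrow> 'a) \<Rightarrow> 'a set" where
  "diff_set M S T = {x \<in> space M. T x \<noteq> S x} \<union> {x \<in> space M. inv T x \<noteq> inv S x}"

text \<open>The functional written \<open>\<mu> \<circ> S\<close> in the literature.\<close>

definition push_integral :: "'a measure \<Rightarrow> ('a \<Rightarrow> 'a) \<Rightarrow> ('a \<Rightarrow> real) \<Rightarrow> real" where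
  "push_integral \<mu> S f = (\<integral>x. f (inv S x) \<partial>\<mu>)"

text \<open>
  The basic neighborhoods of an automorphism \<open>T\<close>; finite families of measures and of Borel sets
  are given as finite sets. In a standard Borel space \<open>diff_set M S T\<close> is measurable for
  \<open>S, T\<close> in \<open>Borel_aut M\<close>, and the supremum in \<open>tau2_nbhds\<close> is over a nonempty set bounded by 2.
\<close>

definition tau_nbhds :: "'a measure \<Rightarrow> ('a \<Rightarrow> 'a) \<Rightarrow> ('a \<Rightarrow> 'a) set set" where
  "tau_nbhds M T =
     {{S \<in> Borel_aut M. \<forall>\<mu>\<in>\<M>. measure \<mu> (diff_set M S T) < \<epsilon>} | \<M> \<epsilon>.
        finite \<M> \<and> \<M> \<subseteq> Borel_probs M \<and> 0 < \<epsilon>}"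

definition tau2_nbhds :: "'a measure \<Rightarrow> ('a \<Rightarrow> 'a) \<Rightarrow> ('a \<Rightarrow> 'a) set set" where
  "tau2_nbhds M T =
     {{S \<in> Borel_aut M. \<forall>\<mu>\<in>\<M>.
          (SUP f\<in>Borel_unit_ball M. \<bar>push_integral \<mu> S f - push_integral \<mu> T f\<bar>) < \<epsilon>} | \<M> \<epsilon>.
        finite \<M> \<and> \<M> \<subseteq> Borel_probs M \<and> 0 < \<epsilon>}"

definition p_nbhds :: "'a measure \<Rightarrow> ('a \<Rightarrow> 'a) \<Rightarrow> ('a \<Rightarrow> 'a) set set" where
  "p_nbhds M T =
     {{S \<in> Borel_aut M. \<forall>F\<in>\<F>. S ` F = T ` F} | \<F>. finite \<F> \<and> \<F> \<subseteq> sets M}"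

definition p_bar_nbhds :: "'a measure \<Rightarrow> ('a \<Rightarrow> 'a) \<Rightarrow> ('a \<Rightarrow> 'a) set set" where
  "p_bar_nbhds M T =
     {{S \<in> Borel_aut M. \<forall>F\<in>\<F>. \<forall>\<mu>\<in>\<M>.
          measure \<mu> (sym_diff (S ` F) (T ` F)) +
          measure \<mu> (sym_diff (inv S ` F) (inv T ` F)) < \<epsilon>} | \<F> \<M> \<epsilon>.
        finite \<F> \<and> \<F> \<subseteq> sets M \<and> finite \<M> \<and> \<M> \<subseteq> Borel_probs M \<and> 0 < \<epsilon>}"

text \<open>
  Each basic neighborhood of \<open>T\<close> contains a basic neighborhood of every one of its points (by the
  triangle inequality, or by transitivity of equality for \<open>p\<close>), and the intersection of two basic
  neighborhoods of \<open>T\<close> contains a third. So these sets form a base of the topology they generate,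
  and those centred at \<open>T\<close> form a neighborhood base at \<open>T\<close>.
\<close>

definition tau_top :: "'a measure \<Rightarrow> ('a \<Rightarrow> 'a) topology" where
  "tau_top M = topology_generated_by (\<Union>T\<in>Borel_aut M. tau_nbhds M T)"

definition tau2_top :: "'a measure \<Rightarrow> ('a \<Rightarrow> 'a) topology" where
  "tau2_top M = topology_generated_by (\<Union>T\<in>Borel_aut M. tau2_nbhds M T)"

definition p_top :: "'a measure \<Rightarrow> ('a \<Rightarrow> 'a) topology" where
  "p_top M = topology_generated_by (\<Union>T\<in>Borel_aut M. p_nbhds M T)"

definition p_bar_top :: "'a measure \<Rightarrow> ('a \<Rightarrow> 'a) topology" where
  "p_bar_top M = topology_generated_by (\<Union>T\<in>Borel_aut M. p_bar_nbhds M T)"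

end

theory Submission
  imports Defs
begin

text \<open>
  Fix \<open>T\<close>, finitely many probability measures and a large \<open>m\<close>. At points of period less
  than \<open>m\<close> keep \<open>T\<close>. On the rest there is a Borel set that every orbit visits with gaps between \<open>m\<close>
  and \<open>2 m - 1\<close>. Its translates by \<open>m\<close> consecutive powers of \<open>T\<close> are disjoint, so for one of
  them all the given measures of the set and of its preimage are small, although no measure is
  assumed invariant. Cutting the orbits at this translate and closing up each piece to a cycle
  gives a \<open>P\<close> of bounded period in \<open>[T]\<close> that differs from \<open>T\<close> only at the cuts. Density for
  \<open>\<tau>''\<close> and \<open>p\<close>-bar follows because \<open>\<tau>\<close> is finer. For \<open>p\<close>, a shift
  on a countable set maps some \<open>F\<close> strictly into itself, which no periodic map does.
\<close>

section \<open>Countable separation and Borel automorphisms\<close>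

text \<open>Standardness enters the later arguments through this sequence, which consists of small
  balls around a countable dense set. A point has positive distance from a finite set that omits it.
  Whole finite sets \<open>D\<close> are avoided because a marker must separate a point from several
  of its iterates at once.\<close>

lemma standard_borel_countable_base:
  assumes "standard_borel M"
  obtains U :: "nat \<Rightarrow> 'a set" where
    "\<And>n. U n \<in> sets M"
    "\<And>x D. x \<in> space M \<Longrightarrow> finite D \<Longrightarrow> x \<notin> D \<Longrightarrow> \<exists>n. x \<in> U n \<and> U n \<inter> D = {}"
proof -
  obtain X where X: "completely_metrizable_space X" "separable_space X" "topspace X = space M"
    "sets M = sigma_sets (topspace X) {U. openin X U}"
    using assms by (auto simp: standard_borel_def)
  have "metrizable_space X"
    using X(1) by (rule completely_metrizable_imp_metrizable_space)
  then obtain S d where Sd: "Metric_space S d" and Xd: "X = Metric_space.mtopology S d"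
    by (auto simp: metrizable_space_def)
  interpret Metric_space S d by fact
  have S: "S = space M" using X(3) Xd by simp
  obtain C where C: "countable C" "C \<subseteq> S" "mtopology closure_of C = S"
    using X(2) Xd by (auto simp: separable_space_def)
  \<comment> \<open>The empty set keeps \<open>B\<close> nonempty even for an empty space, so that
    \<open>from_nat_into\<close> enumerates it.\<close>
  define B where "B = insert {} ((\<lambda>(c,n). mball c (1 / real (Suc n))) ` (C \<times> UNIV))"
  have B: "countable B" "B \<noteq> {}" using C(1) by (auto simp: B_def)
  have openB: "V \<in> sets M" if "V \<in> B" for V
  proof -
    have "openin X V" using that Xd by (auto simp: B_def)
    then show ?thesis using X(4) by (auto intro: sigma_sets.Basic)
  qed
  have sep: "\<exists>V\<in>B. x \<in> V \<and> V \<inter> D = {}" if x: "x \<in> space M" and D: "finite D" "x \<notin> D" for x D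
  proof -
    obtain e where e: "e > 0" "\<And>y. y \<in> D \<inter> S \<Longrightarrow> e \<le> d x y"
    proof
      let ?e = "Min (insert 1 (d x ` (D \<inter> S)))"
      show "?e > 0" using D x S by (subst Min_gr_iff) auto
      show "?e \<le> d x y" if "y \<in> D \<inter> S" for y
        using D that by (intro Min_le) auto
    qed
    \<comment> \<open>Half of \<open>e\<close>: the centre \<open>c\<close> is closer than this to
      \<open>x\<close>, and the ball around \<open>c\<close> has smaller radius, so no point of
      \<open>D\<close> fits into it.\<close>
    obtain n where n: "1 / real (Suc n) < e / 2"
      using nat_approx_posE[of "e/2"] e(1) by auto
    have "x \<in> mtopology closure_of C" using x S C by simp
    then obtain c where c: "c \<in> C" "d x c < 1 / real (Suc n)"
      unfolding metric_closure_of by (auto dest: spec[of _ "1 / real (Suc n)"])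
    have xS: "x \<in> S" and cS: "c \<in> S" using x S c C by auto
    have "mball c (1 / real (Suc n)) \<inter> D = {}"
    proof (rule ccontr)
      assume "\<not> ?thesis"
      then obtain y where y: "y \<in> D" "y \<in> S" "d c y < 1 / real (Suc n)" by auto
      have "d x y \<le> d x c + d c y" using triangle xS cS y by blast
      then show False using e(2)[of y] y c n by auto
    qed
    moreover have "x \<in> mball c (1 / real (Suc n))"
      using c(2) cS xS by (simp add: commute)
    ultimately show ?thesis using c(1) by (auto simp: B_def)
  qed
  show thesis
  proof (rule that[of "from_nat_into B"])
    show "from_nat_into B n \<in> sets M" for n
      using openB from_nat_into[OF B(2)] by auto
    show "\<exists>n. x \<in> from_nat_into B n \<and> from_nat_into B n \<inter> D = {}"
      if "x \<in> space M" "finite D" "x \<notin> D" for x D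
      using sep[OF that] from_nat_into_surj[OF B(1)] by metis
  qed
qed

lemma Borel_autD:
  assumes "T \<in> Borel_aut M"
  shows "T permutes space M" "T \<in> measurable M M" "inv T \<in> measurable M M"
    "bij T" "\<And>x. T (inv T x) = x" "\<And>x. inv T (T x) = x"
    "\<And>x. T x \<in> space M \<longleftrightarrow> x \<in> space M" "\<And>x. inv T x \<in> space M \<longleftrightarrow> x \<in> space M"
proof -
  show p: "T permutes space M" "T \<in> measurable M M" "inv T \<in> measurable M M"
    using assms by (auto simp: Borel_aut_def)
  show "bij T" "T (inv T x) = x" "inv T (T x) = x" for x
    using p(1) permutes_bij permutes_inverses by metis+
  show "T x \<in> space M \<longleftrightarrow> x \<in> space M" "inv T x \<in> space M \<longleftrightarrow> x \<in> space M" for x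
    using permutes_in_image p(1) permutes_inv by metis+
qed

lemma id_Borel_aut: "id \<in> Borel_aut M"
  by (auto simp: Borel_aut_def permutes_id inv_id)

lemma funpow_mem_iff:
  assumes "\<And>x. f x \<in> A \<longleftrightarrow> x \<in> A"
  shows "(f ^^ n) x \<in> A \<longleftrightarrow> x \<in> A"
  by (induction n) (auto simp: assms)

lemma funpow_inverse_cancel:
  fixes f g :: "'a \<Rightarrow> 'a"
  assumes "\<And>x. f (g x) = x"
  shows "(f ^^ n) ((g ^^ n) x) = x"
proof (induction n arbitrary: x)
  case (Suc n)
  have "(f ^^ Suc n) ((g ^^ Suc n) x) = f ((f ^^ n) ((g ^^ n) (g x)))"
    by (metis comp_apply funpow.simps(2) funpow_Suc_right)
  then show ?case by (simp add: Suc.IH assms)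
qed simp

lemma funpow_apply_funpow: "(f ^^ i) ((f ^^ j) x) = (f ^^ (i + j)) x"
  by (simp add: funpow_add)

lemma funpow_commute: "(f ^^ i) ((f ^^ j) x) = (f ^^ j) ((f ^^ i) x)"
  by (simp add: funpow_apply_funpow add.commute)

lemma funpow_split: "i \<le> k \<Longrightarrow> (f ^^ k) x = (f ^^ i) ((f ^^ (k - i)) x)"
  by (simp add: funpow_apply_funpow)

text \<open>Two measurable maps differ at \<open>x\<close> exactly when some \<open>U n\<close>
  contains one value and not the other; only countably many \<open>n\<close> are involved.\<close>

lemma diff_set_measurable:
  assumes "standard_borel M" and S: "S \<in> Borel_aut M" and T: "T \<in> Borel_aut M"
  shows "diff_set M S T \<in> sets M"
proof -
  obtain U :: "nat \<Rightarrow> 'a set" where U [measurable]: "\<And>n. U n \<in> sets M"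
    and sep: "\<And>x D. x \<in> space M \<Longrightarrow> finite D \<Longrightarrow> x \<notin> D \<Longrightarrow> \<exists>n. x \<in> U n \<and> U n \<inter> D = {}"
    using standard_borel_countable_base[OF assms(1)] by blast
  have neq: "{x \<in> space M. f x \<noteq> g x} \<in> sets M"
    if [measurable]: "f \<in> measurable M M" "g \<in> measurable M M" for f g
  proof -
    have "{x \<in> space M. f x \<noteq> g x} = {x \<in> space M. \<exists>n. f x \<in> U n \<and> g x \<notin> U n}"
      using sep[of "f _" "{g _}"] measurable_space[OF that(1)] by fastforce
    also have "\<dots> \<in> sets M" by measurable
    finally show ?thesis .
  qed
  show ?thesis
    unfolding diff_set_def using Borel_autD(2,3)[OF S] Borel_autD(2,3)[OF T]
    by (intro sets.Un neq) auto
qed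

section \<open>Markers, cutting of orbits and periodic approximation\<close>

text \<open>A greedy choice along a countable cover by partial markers; the result is a maximal set
  that \<open>T\<close> does not return to before time \<open>m\<close>.\<close>

lemma marker_set:
  fixes T :: "'a \<Rightarrow> 'a" and m :: nat
  assumes "standard_borel M" and T: "T \<in> Borel_aut M" and "0 < m"
  defines "Y \<equiv> {x \<in> space M. \<forall>i\<in>{1..<m}. (T ^^ i) x \<noteq> x}"
  obtains A where "A \<in> sets M" "A \<subseteq> Y"
    "\<And>x i. x \<in> A \<Longrightarrow> i \<in> {1..<m} \<Longrightarrow> (T ^^ i) x \<notin> A"
    "\<And>x. x \<in> Y \<Longrightarrow> \<exists>j\<in>{0<..<2*m}. (T ^^ j) x \<in> A"
proof -
  obtain U :: "nat \<Rightarrow> 'a set" where U [measurable]: "\<And>n. U n \<in> sets M"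
    and sep: "\<And>x D. x \<in> space M \<Longrightarrow> finite D \<Longrightarrow> x \<notin> D \<Longrightarrow> \<exists>n. x \<in> U n \<and> U n \<inter> D = {}"
    using standard_borel_countable_base[OF assms(1)] by blast
  note [measurable] = Borel_autD(2,3)[OF T]
  note inverse = Borel_autD(5,6)[OF T]
  define S where "S = inv T"
  have [measurable]: "S \<in> measurable M M" by (simp add: S_def)
  have TS: "T (S x) = x" and ST: "S (T x) = x" for x using inverse by (auto simp: S_def)
  \<comment> \<open>Two points of the same \<open>C k\<close> are never fewer than \<open>m\<close>
    steps apart along \<open>T\<close>, unless they coincide. So adding points of \<open>C k\<close>
    to a partial marker can create conflicts only with points chosen before.\<close>
  define C where "C k = {x \<in> U k. \<forall>i\<in>{1..<m}. (T ^^ i) x \<notin> U k}" for k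
  have C_eq: "C k = {x \<in> space M. x \<in> U k \<and> (\<forall>i\<in>{1..<m}. (T ^^ i) x \<notin> U k)}" for k
    using sets.sets_into_space[OF U] by (auto simp: C_def)
  have C_meas [measurable]: "C k \<in> sets M" for k
    unfolding C_eq by measurable
  have C_Y: "C k \<subseteq> Y" for k
    by (auto simp: C_eq Y_def) 
  have cover: "\<exists>k. x \<in> C k" if "x \<in> Y" for x
  proof -
    have "x \<in> space M" "x \<notin> (\<lambda>i. (T ^^ i) x) ` {1..<m}" using that by (force simp: Y_def)+
    then obtain k where "x \<in> U k" "U k \<inter> (\<lambda>i. (T ^^ i) x) ` {1..<m} = {}"
      using sep[of x "(\<lambda>i. (T ^^ i) x) ` {1..<m}"] by auto
    then have "x \<in> C k" by (auto simp: C_def)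
    then show ?thesis ..
  qed
  \<comment> \<open>Both directions are tested, since an earlier chosen point may lie ahead of the
    new one or behind it.\<close>
  define G where "G = rec_nat {} (\<lambda>k G. G \<union>
    {x \<in> C k. \<forall>i\<in>{1..<m}. (T ^^ i) x \<notin> G \<and> (S ^^ i) x \<notin> G})"
  have G0: "G 0 = {}" and GS: "G (Suc k) = G k \<union>
    {x \<in> C k. \<forall>i\<in>{1..<m}. (T ^^ i) x \<notin> G k \<and> (S ^^ i) x \<notin> G k}" for k
    by (simp_all add: G_def)
  have G_meas [measurable]: "G k \<in> sets M" for k
  proof (induction k)
    case (Suc k)
    have [measurable]: "G k \<in> sets M" by fact
    have "G (Suc k) = G k \<union>
      {x \<in> space M. x \<in> C k \<and> (\<forall>i\<in>{1..<m}. (T ^^ i) x \<notin> G k \<and> (S ^^ i) x \<notin> G k)}"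
      using sets.sets_into_space[OF C_meas] by (auto simp: GS)
    also have "\<dots> \<in> sets M" by measurable
    finally show ?case .
  qed (simp add: G0)
  have G_Y: "G k \<subseteq> Y" for k
    by (induction k) (use C_Y in \<open>auto simp: G0 GS\<close>)
  have G_mono: "G i \<subseteq> G j" if "i \<le> j" for i j
    by (rule lift_Suc_mono_le[OF _ that]) (auto simp: GS)
  have cancel: "(S ^^ i) ((T ^^ i) x) = x" "(T ^^ i) ((S ^^ i) x) = x" for i x
    using funpow_inverse_cancel[of S T] funpow_inverse_cancel[of T S] ST TS by auto
  have G_indep: "(T ^^ i) x \<notin> G k" if "x \<in> G k" "i \<in> {1..<m}" for k x i
    using that
  proof (induction k)
    case (Suc k)
    show ?case
    proof
      assume "(T ^^ i) x \<in> G (Suc k)"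
      \<comment> \<open>If the later point is old, either the induction hypothesis or the forward
        test at \<open>x\<close> excludes it. If it is new, its backward test makes \<open>x\<close>
        new as well, and two points of \<open>C k\<close> cannot be this close.\<close>
      then consider "(T ^^ i) x \<in> G k" | "(T ^^ i) x \<in> C k" "(S ^^ i) ((T ^^ i) x) \<notin> G k"
        using Suc.prems(2) unfolding GS by blast
      then show False
      proof cases
        case 1
        then show False using Suc by (auto simp: GS)
      next
        case 2
        then have "x \<notin> G k" using cancel(1) by simp
        then show False using 2(1) Suc.prems by (auto simp: GS C_def)
      qed
    qed
  qed (simp add: G0)
  have TY: "(T ^^ n) x \<in> Y \<longleftrightarrow> x \<in> Y" for n x
  proof (rule funpow_mem_iff)
    fix x
    have "(T ^^ i) (T x) = T x \<longleftrightarrow> (T ^^ i) x = x" for i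
      by (metis ST funpow_swap1)
    then show "T x \<in> Y \<longleftrightarrow> x \<in> Y"
      by (auto simp: Y_def Borel_autD(7)[OF T])
  qed
  show thesis
  proof (rule that[of "\<Union>k. G k"])
    show "(\<Union>k. G k) \<in> sets M" by measurable
    show "(\<Union>k. G k) \<subseteq> Y" using G_Y by auto
    show "(T ^^ i) x \<notin> (\<Union>k. G k)" if x: "x \<in> (\<Union>k. G k)" and "i \<in> {1..<m}" for x i
    proof
      assume "(T ^^ i) x \<in> (\<Union>k. G k)"
      then obtain k l where "x \<in> G k" "(T ^^ i) x \<in> G l" using x by auto
      then have "x \<in> G (max k l)" "(T ^^ i) x \<in> G (max k l)"
        using G_mono by (meson max.cobounded1 max.cobounded2 subsetD)+
      then show False using G_indep that(2) by blast
    qed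
    show "\<exists>j\<in>{0<..<2*m}. (T ^^ j) x \<in> (\<Union>k. G k)" if "x \<in> Y" for x
    proof -
      \<comment> \<open>The search is centred at time \<open>m\<close>: a marker point fewer than
        \<open>m\<close> steps before or after \<open>?y\<close> is reached from \<open>x\<close> at
        a positive time below \<open>2 * m\<close>.\<close>
      let ?y = "(T ^^ m) x"
      obtain k where "?y \<in> C k" using cover TY \<open>x \<in> Y\<close> by blast
      then consider "?y \<in> G (Suc k)" | i where "i \<in> {1..<m}" "(T ^^ i) ?y \<in> G k"
        | i where "i \<in> {1..<m}" "(S ^^ i) ?y \<in> G k"
        unfolding GS by blast
      then show ?thesis
      proof cases
        case 1
        then show ?thesis using \<open>0 < m\<close> by (intro bexI[of _ m]) auto
      next
        case 2
        then have "(T ^^ (i + m)) x \<in> G k" by (simp add: funpow_add)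
        then show ?thesis using 2 by (intro bexI[of _ "i + m"]) auto
      next
        case 3
        have "?y = (T ^^ i) ((T ^^ (m - i)) x)"
          using 3(1) by (intro funpow_split) auto
        then have "(T ^^ (m - i)) x \<in> G k" using 3(2) cancel(1) by simp
        then show ?thesis using 3(1) by (intro bexI[of _ "m - i"]) auto
      qed
    qed
  qed
qed

text \<open>\<open>P\<close> follows \<open>T\<close> except that, instead of entering \<open>A\<close>, it jumps back to the last visit
  to \<open>A\<close>; so \<open>P\<close> permutes cyclically each piece of an orbit between two visits.\<close>

lemma cyclic_cut:
  fixes T :: "'a \<Rightarrow> 'a" and m :: nat
  assumes T: "T \<in> Borel_aut M" and A [measurable]: "A \<in> sets M" and "0 < m"
    and return: "\<And>x. x \<in> Y \<Longrightarrow> \<exists>j\<in>{0<..<2*m}. (T ^^ j) x \<in> A"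
    and Y: "A \<subseteq> Y" "\<And>x. T x \<in> Y \<longleftrightarrow> x \<in> Y"
    and short: "\<And>x. x \<in> space M - Y \<Longrightarrow> \<exists>i\<in>{1..<m}. (T ^^ i) x = x"
  obtains P where "P \<in> Per0 M" "\<And>x. \<exists>i j. (T ^^ i) (P x) = (T ^^ j) x"
    "\<And>x. T x \<notin> A \<Longrightarrow> P x = T x"
proof -
  note [measurable] = Borel_autD(2,3)[OF T]
  define S where "S = inv T"
  have S_meas [measurable]: "S \<in> measurable M M" by (simp add: S_def)
  have TS: "T (S x) = x" and ST: "S (T x) = x" for x
    using Borel_autD(5,6)[OF T] by (auto simp: S_def)
  have cancel: "(S ^^ i) ((T ^^ i) x) = x" "(T ^^ i) ((S ^^ i) x) = x" for i x
    using funpow_inverse_cancel[of S T] funpow_inverse_cancel[of T S] ST TS by auto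
  have cancel_le: "(S ^^ i) ((T ^^ k) x) = (T ^^ (k - i)) x" if "i \<le> k" for i k x
    by (simp add: funpow_split[OF that, of T] cancel)
  have cancel_le': "(T ^^ i) ((S ^^ k) x) = (S ^^ (k - i)) x" if "i \<le> k" for i k x
    by (simp add: funpow_split[OF that, of S] cancel)
  have SY: "S x \<in> Y \<longleftrightarrow> x \<in> Y" for x using Y(2)[of "S x"] TS by simp
  have TnY: "(T ^^ n) x \<in> Y \<longleftrightarrow> x \<in> Y" "(S ^^ n) x \<in> Y \<longleftrightarrow> x \<in> Y" for n x
    using funpow_mem_iff[of T Y] funpow_mem_iff[of S Y] Y(2) SY by auto
  \<comment> \<open>The number of steps back to the last visit, 0 on \<open>A\<close> itself.
    \<open>P\<close> uses \<open>b x\<close> only when \<open>T x\<close> is in \<open>A\<close>;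
    then \<open>x\<close> is in \<open>Y\<close>, where a visit in the past exists.\<close>
  define b where "b x = (LEAST n. (S ^^ n) x \<in> A)" for x
  define P where "P x = (if T x \<in> A then (S ^^ b x) x else T x)" for x
  \<comment> \<open>All cycles of \<open>P\<close> turn out to be shorter than \<open>2 * m\<close>,
    so this factorial is a common multiple of their lengths.\<close>
  define N :: nat where "N = fact (2 * m)"
  have N: "l dvd N" if "0 < l" "l < 2 * m" for l
    unfolding N_def using that by (intro dvd_fact) auto
  have period: "(P ^^ N) x = x" if "(P ^^ L) x = x" "0 < L" "L < 2 * m" for L x
  proof -
    have "L dvd N" using that(2,3) by (rule N)
    then obtain q where "N = L * q" ..
    moreover have "((P ^^ L) ^^ q) x = x" using that(1) by (induction q) auto
    ultimately show ?thesis by (simp add: funpow_mult)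
  qed
  have out: "P x = x" if "x \<notin> space M" for x
  proof -
    have "T x = x" using Borel_autD(1)[OF T] that by (rule permutes_not_in)
    then show ?thesis using that sets.sets_into_space[OF A] by (auto simp: P_def)
  qed
  have PN: "(P ^^ N) x = x" for x
  proof -
    consider "x \<notin> space M" | "x \<in> space M - Y" | "x \<in> Y" by blast
    then show ?thesis
    proof cases
      case 1
      then have "(P ^^ 1) x = x" by (simp add: out)
      then show ?thesis using \<open>0 < m\<close> by (intro period[of 1]) auto
    next
      case 2
      have "(P ^^ i) x = (T ^^ i) x" for i
      proof (induction i)
        case (Suc i)
        have "T ((T ^^ i) x) \<notin> A" using 2 Y TnY by blast
        then show ?case using Suc by (simp add: P_def)
      qed simp
      moreover obtain i where "i \<in> {1..<m}" "(T ^^ i) x = x" using short 2 by blast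
      ultimately show ?thesis by (intro period[of i]) auto
    next
      case 3
      define a where "a = (S ^^ b x) x"
      \<comment> \<open>Going back \<open>2 * m\<close> steps and then forward to a return ends in
        \<open>A\<close> strictly before \<open>x\<close>. This is the past visit that makes the
        \<open>LEAST\<close> in \<open>b x\<close> meaningful.\<close>
      obtain n where "0 < n" "n < 2 * m" "(T ^^ n) ((S ^^ (2 * m)) x) \<in> A"
        using return[of "(S ^^ (2 * m)) x"] TnY 3 by auto
      then have "(S ^^ (2 * m - n)) x \<in> A" by (simp add: cancel_le')
      then have a: "a \<in> A" unfolding a_def b_def by (rule LeastI)
      \<comment> \<open>\<open>L\<close> is the length of the piece that starts at \<open>a\<close>.
        On the piece \<open>P\<close> agrees with \<open>T\<close> up to the last point
        \<open>(T ^^ (L - 1)) a\<close>, which it sends back to \<open>a\<close>.\<close>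
      define L where "L = (LEAST l. 0 < l \<and> (T ^^ l) a \<in> A)"
      obtain j where j: "0 < j" "j < 2 * m" "(T ^^ j) a \<in> A"
        using return[of a] a Y(1) by fastforce
      then have "0 < L \<and> (T ^^ L) a \<in> A" 
        using LeastI[of "\<lambda>l. 0 < l \<and> (T ^^ l) a \<in> A" j] j by (simp add: L_def)
      then have L: "0 < L" "(T ^^ L) a \<in> A" by auto
      have L_less: "L < 2 * m"
        using Least_le[of "\<lambda>l. 0 < l \<and> (T ^^ l) a \<in> A" j] j by (simp add: L_def)
      have L_min: "(T ^^ l) a \<notin> A" if "0 < l" "l < L" for l
        using not_less_Least[of l "\<lambda>l. 0 < l \<and> (T ^^ l) a \<in> A"] that by (auto simp: L_def)
      have Pj: "(P ^^ j) a = (T ^^ j) a" if "j < L" for j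
        using that
      proof (induction j)
        case (Suc j)
        have "T ((T ^^ j) a) \<notin> A" using L_min[of "Suc j"] Suc.prems by simp
        then show ?case using Suc by (simp add: P_def)
      qed simp
      have "b ((T ^^ (L - 1)) a) = L - 1"
        unfolding b_def
      proof (rule Least_equality)
        show "(S ^^ (L - 1)) ((T ^^ (L - 1)) a) \<in> A" using a cancel by simp
        show "L - 1 \<le> n" if "(S ^^ n) ((T ^^ (L - 1)) a) \<in> A" for n
        proof (rule ccontr)
          assume "\<not> ?thesis"
          then have n: "n < L - 1" by simp
          then have "(T ^^ (L - 1 - n)) a \<in> A" using that cancel_le[of n "L - 1"] by simp
          moreover have "0 < L - 1 - n" "L - 1 - n < L" using n by linarith+
          ultimately show False using L_min by blast
        qed
      qed
      moreover have "T ((T ^^ (L - 1)) a) \<in> A"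
        using L by (cases L) auto
      ultimately have "P ((T ^^ (L - 1)) a) = a" using cancel by (simp add: P_def)
      moreover have "(P ^^ L) a = P ((P ^^ (L - 1)) a)" using L(1) by (cases L) auto
      ultimately have PL: "(P ^^ L) a = a" using Pj[of "L - 1"] L(1) by simp
      \<comment> \<open>Otherwise \<open>(T ^^ L) a\<close> would be a visit to \<open>A\<close>
        later than \<open>a\<close> and not after \<open>x\<close>, against the choice of
        \<open>a\<close> as the last one. Hence \<open>x\<close> lies on the piece and inherits its
        period.\<close>
      have bL: "b x < L"
      proof (rule ccontr)
        assume *: "\<not> ?thesis"
        then have "(S ^^ (b x - L)) x \<in> A" using L(2) cancel_le'[of L "b x"] by (simp add: a_def)
        then have "b x \<le> b x - L" unfolding b_def by (rule Least_le)
        then show False using L(1) * by simp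
      qed
      have "x = (P ^^ b x) a" using Pj[OF bL] cancel by (simp add: a_def)
      then have "(P ^^ L) x = (P ^^ L) ((P ^^ b x) a)" by simp
      also have "\<dots> = (P ^^ b x) ((P ^^ L) a)" by (rule funpow_commute)
      also have "\<dots> = x" using PL \<open>x = (P ^^ b x) a\<close> by simp
      finally show ?thesis using L(1) L_less by (intro period[of L]) auto
    qed
  qed
  have "0 < N" by (simp add: N_def)
  \<comment> \<open>A common period makes the inverse a power of \<open>P\<close>, which gives
    bijectivity and, once \<open>P\<close> is measurable, measurability of
    \<open>inv P\<close>.\<close>
  have inverse: "P ((P ^^ (N - 1)) x) = x" "(P ^^ (N - 1)) (P x) = x" for x
    using PN[of x] \<open>0 < N\<close> by (cases N; simp add: funpow_swap1)+
  have comp: "P \<circ> P ^^ (N - 1) = id" "P ^^ (N - 1) \<circ> P = id"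
    by (rule ext, simp only: comp_apply id_apply inverse)+
  have "bij P" by (rule o_bij[OF comp(2,1)])
  then have permutes: "P permutes space M"
    by (auto simp: permutes_def bij_iff out)
  have inv_P: "inv P = P ^^ (N - 1)" by (rule inv_unique_comp[OF comp])
  have b_meas [measurable]: "b \<in> measurable M (count_space UNIV)"
    unfolding b_def by measurable
  have P_meas [measurable]: "P \<in> measurable M M"
    unfolding P_def
    by (intro measurable_If measurable_compose_countable[where f = "\<lambda>n x. (S ^^ n) x" and g = b]) measurable
  have "inv P \<in> measurable M M" unfolding inv_P by measurable
  then have "P \<in> Borel_aut M" using permutes by (simp add: Borel_aut_def)
  moreover have "\<exists>N\<ge>1. \<forall>x\<in>space M. (P ^^ N) x = x"
    using PN \<open>0 < N\<close> by (intro exI[of _ N]) auto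
  ultimately have "P \<in> Per0 M" unfolding Per0_def by blast
  moreover have "\<exists>i j. (T ^^ i) (P x) = (T ^^ j) x" for x
  proof (cases "T x \<in> A")
    case True
    then have "(T ^^ b x) (P x) = (T ^^ 0) x" by (simp add: P_def cancel)
    then show ?thesis by blast
  next
    case False
    then have "(T ^^ 0) (P x) = (T ^^ 1) x" by (simp add: P_def)
    then show ?thesis by blast
  qed
  moreover have "P x = T x" if "T x \<notin> A" for x using that by (simp add: P_def)
  ultimately show thesis by (rule that)
qed

text \<open>The marker set itself may have large measure, so the cut is made at one of its
  preimages, chosen by averaging. The relation between powers of \<open>T\<close> is kept in the
  conclusion because it later places \<open>P\<close> in the full group.\<close>

lemma periodic_approximation:
  fixes T :: "'a \<Rightarrow> 'a" and \<epsilon> :: real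
  assumes sb: "standard_borel M" and T: "T \<in> Borel_aut M"
    and \<M>: "finite \<M>" "\<M> \<subseteq> Borel_probs M" and "0 < \<epsilon>"
  obtains P where "P \<in> Per0 M" "\<And>x. \<exists>i j. (T ^^ i) (P x) = (T ^^ j) x"
    "\<And>\<mu>. \<mu> \<in> \<M> \<Longrightarrow> measure \<mu> (diff_set M P T) < \<epsilon>"
proof -
  \<comment> \<open>Each measure contributes at most 2 to the sum of the \<open>m\<close> costs
    \<open>v i\<close> below. Since \<open>m * \<epsilon>\<close> exceeds the resulting bound
    \<open>2 * card \<M>\<close>, some cost is below \<open>\<epsilon>\<close>.\<close>
  obtain m0 :: nat where m0: "2 * real (card \<M>) / \<epsilon> < real m0"
    using reals_Archimedean2 by blast
  define m where "m = Suc m0"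
  have m: "2 * real (card \<M>) / \<epsilon> < real m" "0 < m" using m0 by (simp_all add: m_def)
  define Y where "Y = {x \<in> space M. \<forall>i\<in>{1..<m}. (T ^^ i) x \<noteq> x}"
  obtain A where A [measurable]: "A \<in> sets M" and AY: "A \<subseteq> Y"
    and indep: "\<And>x i. x \<in> A \<Longrightarrow> i \<in> {1..<m} \<Longrightarrow> (T ^^ i) x \<notin> A"
    and return: "\<And>x. x \<in> Y \<Longrightarrow> \<exists>j\<in>{0<..<2*m}. (T ^^ j) x \<in> A"
    using marker_set[OF sb T m(2)] unfolding Y_def by blast
  note [measurable] = Borel_autD(2,3)[OF T]
  have TY: "T x \<in> Y \<longleftrightarrow> x \<in> Y" for x
  proof -
    have "(T ^^ i) (T x) = T x \<longleftrightarrow> (T ^^ i) x = x" for i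
      by (metis Borel_autD(6)[OF T] funpow_swap1)
    then show ?thesis by (auto simp: Y_def Borel_autD(7)[OF T])
  qed
  have TnY: "(T ^^ n) x \<in> Y \<longleftrightarrow> x \<in> Y" for n x
    by (rule funpow_mem_iff) (rule TY)
  define B where "B i = {x \<in> space M. (T ^^ i) x \<in> A}" for i
  have B [measurable]: "B i \<in> sets M" for i unfolding B_def by measurable
  have disj: "disjoint_family_on B {k..<k+m}" for k
  proof -
    have later: "B i \<inter> B j = {}" if "i < j" "j < i + m" for i j
    proof (rule ccontr)
      assume "\<not> ?thesis"
      then obtain x where x: "(T ^^ i) x \<in> A" "(T ^^ j) x \<in> A" by (auto simp: B_def)
      have "(T ^^ j) x = (T ^^ (j - i)) ((T ^^ i) x)"
        using that(1) by (simp add: funpow_apply_funpow)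
      moreover have "j - i \<in> {1..<m}" using that by auto
      ultimately show False using indep[OF x(1), of "j - i"] x(2) by simp
    qed
    have "B i \<inter> B j = {}" if "i \<noteq> j" "i \<in> {k..<k+m}" "j \<in> {k..<k+m}" for i j
    proof (cases i j rule: linorder_cases)
      case less
      then show ?thesis using later[of i j] that by simp
    next
      case greater
      then have "B j \<inter> B i = {}" using later[of j i] that by simp
      then show ?thesis by blast
    qed (use that in simp)
    then show ?thesis unfolding disjoint_family_on_def by blast
  qed
  \<comment> \<open>Any \<open>m\<close> consecutive preimages are disjoint, so no invariance of the
    measure is needed. The windows starting at 0 and at 1 are the ones used.\<close>
  have sum_le: "(\<Sum>i\<in>{k..<k+m}. measure \<mu> (B i)) \<le> 1" if "\<mu> \<in> \<M>" for \<mu> k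
  proof -
    interpret prob_space \<mu> using \<M>(2) that by (auto simp: Borel_probs_def)
    have "sets \<mu> = sets M" using \<M>(2) that by (auto simp: Borel_probs_def)
    then have "(\<Sum>i\<in>{k..<k+m}. measure \<mu> (B i)) = measure \<mu> (\<Union>i\<in>{k..<k+m}. B i)"
      using disj B by (intro finite_measure_finite_Union[symmetric]) auto
    then show ?thesis by simp
  qed
  \<comment> \<open>Adding up over all measures yields one index good for all of them.
    \<open>B (Suc i)\<close> is included because it is the preimage of the cut
    \<open>B i\<close>.\<close>
  define v where "v i = (\<Sum>\<mu>\<in>\<M>. measure \<mu> (B i) + measure \<mu> (B (Suc i)))" for i
  have "\<exists>i<m. v i < \<epsilon>"
  proof (rule ccontr)
    assume "\<not> ?thesis"
    then have "(\<Sum>i<m. \<epsilon>) \<le> (\<Sum>i<m. v i)" by (intro sum_mono) auto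
    also have "\<dots> = (\<Sum>\<mu>\<in>\<M>. (\<Sum>i<m. measure \<mu> (B i)) + (\<Sum>i<m. measure \<mu> (B (Suc i))))"
      unfolding v_def by (subst sum.swap) (simp add: sum.distrib)
    also have "\<dots> \<le> (\<Sum>\<mu>\<in>\<M>. 2)"
    proof (rule sum_mono)
      fix \<mu> assume \<mu>: "\<mu> \<in> \<M>"
      have "(\<Sum>i<m. measure \<mu> (B (Suc i))) = (\<Sum>i\<in>{1..<1+m}. measure \<mu> (B i))"
        by (rule sum.reindex_bij_witness[of _ "\<lambda>i. i - 1" Suc]) auto
      then show "(\<Sum>i<m. measure \<mu> (B i)) + (\<Sum>i<m. measure \<mu> (B (Suc i))) \<le> 2"
        using sum_le[OF \<mu>, of 0] sum_le[OF \<mu>, of 1] by (simp add: atLeast0LessThan)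
    qed
    finally have "real m * \<epsilon> \<le> 2 * real (card \<M>)" by simp
    then show False using m(1) \<open>0 < \<epsilon>\<close> by (simp add: field_simps)
  qed
  then obtain i where i: "v i < \<epsilon>" by blast
  have returns: "\<exists>j\<in>{0<..<2*m}. (T ^^ j) x \<in> B i" if x: "x \<in> Y" for x
  proof -
    obtain j where j: "j \<in> {0<..<2*m}" "(T ^^ j) ((T ^^ i) x) \<in> A"
      using return[of "(T ^^ i) x"] x TnY by auto
    have "(T ^^ i) ((T ^^ j) x) = (T ^^ j) ((T ^^ i) x)"
      by (rule funpow_commute)
    moreover have "(T ^^ j) x \<in> space M" using x TnY[of j x] by (auto simp: Y_def)
    ultimately show ?thesis using j by (auto simp: B_def)
  qed
  have B_Y: "B i \<subseteq> Y"
    using AY TnY by (auto simp: B_def)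
  have short: "\<exists>i\<in>{1..<m}. (T ^^ i) x = x" if "x \<in> space M - Y" for x
    using that by (auto simp: Y_def)
  obtain P where P: "P \<in> Per0 M" "\<And>x. \<exists>i j. (T ^^ i) (P x) = (T ^^ j) x"
    and PT: "\<And>x. T x \<notin> B i \<Longrightarrow> P x = T x"
    using cyclic_cut[OF T B m(2) returns B_Y TY short] by metis
  have P_aut: "P \<in> Borel_aut M" using P(1) by (simp add: Per0_def)
  \<comment> \<open>\<open>P\<close> can differ from \<open>T\<close> only at points that
    \<open>T\<close> sends into \<open>B i\<close>, and these lie in \<open>B (Suc i)\<close>;
    \<open>inv P\<close> can differ from \<open>inv T\<close> only on \<open>B i\<close>
    itself.\<close>
  have sub: "diff_set M P T \<subseteq> B i \<union> B (Suc i)"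
  proof
    fix x assume x: "x \<in> diff_set M P T"
    then have "x \<in> space M" by (auto simp: diff_set_def)
    have "P (inv T x) = x" if "x \<notin> B i"
      using PT[of "inv T x"] that Borel_autD(5)[OF T] by simp
    then have "inv P x = inv T x" if "x \<notin> B i"
      using that Borel_autD(6)[OF P_aut] by metis
    moreover have "x \<in> B (Suc i)" if "T x \<in> B i"
      using that \<open>x \<in> space M\<close> by (simp add: B_def funpow_swap1)
    moreover have "T x \<noteq> P x \<or> inv T x \<noteq> inv P x" using x by (auto simp: diff_set_def)
    ultimately show "x \<in> B i \<union> B (Suc i)" using PT[of x] by fastforce
  qed
  have "measure \<mu> (diff_set M P T) < \<epsilon>" if \<mu>: "\<mu> \<in> \<M>" for \<mu>
  proof -
    interpret prob_space \<mu> using \<M>(2) \<mu> by (auto simp: Borel_probs_def)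
    have [simp]: "sets \<mu> = sets M" using \<M>(2) \<mu> by (auto simp: Borel_probs_def)
    have "measure \<mu> (diff_set M P T) \<le> measure \<mu> (B i \<union> B (Suc i))"
      using sub by (intro finite_measure_mono) auto
    also have "\<dots> \<le> measure \<mu> (B i) + measure \<mu> (B (Suc i))"
      by (intro measure_Un_le) auto
    also have "\<dots> \<le> v i"
      unfolding v_def using \<mu> \<M>(1) by (intro member_le_sum) auto
    finally show ?thesis using i by simp
  qed
  then show thesis using that P by blast
qed

section \<open>Density in topologies coarser than tau\<close>

lemma tau_nbhds_Int:
  assumes "W1 \<in> tau_nbhds M T" "W2 \<in> tau_nbhds M T"
  shows "\<exists>W\<in>tau_nbhds M T. W \<subseteq> W1 \<inter> W2"
proof -
  obtain \<M>1 \<epsilon>1 where W1: "W1 = {S \<in> Borel_aut M. \<forall>\<mu>\<in>\<M>1. measure \<mu> (diff_set M S T) < \<epsilon>1}"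
    "finite \<M>1" "\<M>1 \<subseteq> Borel_probs M" "0 < \<epsilon>1"
    using assms(1) by (auto simp: tau_nbhds_def)
  obtain \<M>2 \<epsilon>2 where W2: "W2 = {S \<in> Borel_aut M. \<forall>\<mu>\<in>\<M>2. measure \<mu> (diff_set M S T) < \<epsilon>2}"
    "finite \<M>2" "\<M>2 \<subseteq> Borel_probs M" "0 < \<epsilon>2"
    using assms(2) by (auto simp: tau_nbhds_def)
  let ?W = "{S \<in> Borel_aut M. \<forall>\<mu>\<in>\<M>1 \<union> \<M>2. measure \<mu> (diff_set M S T) < min \<epsilon>1 \<epsilon>2}"
  have "?W \<in> tau_nbhds M T"
    unfolding tau_nbhds_def using W1(2-4) W2(2-4)
    by (intro CollectI exI[of _ "\<M>1 \<union> \<M>2"] exI[of _ "min \<epsilon>1 \<epsilon>2"]) auto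
  moreover have "?W \<subseteq> W1 \<inter> W2" using W1(1) W2(1) by auto
  ultimately show ?thesis by blast
qed

text \<open>Finitely many strict inequalities at \<open>T\<close> leave a smallest slack, and half
  of it is an admissible radius. The basic neighborhoods of tau, tau'' and p-bar are all sublevel
  sets of this kind. The factor 2 fits both the oscillation of functions bounded by 1 and the two
  terms of p-bar.\<close>

lemma tau_nbhd_sublevel:
  fixes d :: "'i \<Rightarrow> ('a \<Rightarrow> 'a) \<Rightarrow> real"
  assumes "finite I" "\<And>i. i \<in> I \<Longrightarrow> m i \<in> Borel_probs M"
    and le: "\<And>i S. i \<in> I \<Longrightarrow> S \<in> Borel_aut M \<Longrightarrow>
      d i S \<le> d i T + 2 * measure (m i) (diff_set M S T)"
    and "\<And>i. i \<in> I \<Longrightarrow> d i T < \<epsilon>"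
  shows "\<exists>W\<in>tau_nbhds M T. W \<subseteq> {S \<in> Borel_aut M. \<forall>i\<in>I. d i S < \<epsilon>}"
proof -
  \<comment> \<open>The inserted 1 provides a minimum when \<open>I\<close> is empty.\<close>
  define \<delta> where "\<delta> = Min (insert 1 ((\<lambda>i. (\<epsilon> - d i T) / 2) ` I))"
  have "0 < \<delta>" unfolding \<delta>_def using assms(1,4) by (subst Min_gr_iff) auto
  have \<delta>: "\<delta> \<le> (\<epsilon> - d i T) / 2" if "i \<in> I" for i
    unfolding \<delta>_def using that assms(1) by (intro Min_le) auto
  let ?W = "{S \<in> Borel_aut M. \<forall>\<mu>\<in>m ` I. measure \<mu> (diff_set M S T) < \<delta>}"
  have "?W \<in> tau_nbhds M T"
    unfolding tau_nbhds_def using assms(1,2) \<open>0 < \<delta>\<close>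
    by (intro CollectI exI[of _ "m ` I"] exI[of _ \<delta>]) auto
  moreover have "d i S < \<epsilon>" if "S \<in> ?W" "i \<in> I" for i S
  proof -
    have "measure (m i) (diff_set M S T) < \<delta>" "S \<in> Borel_aut M" using that by auto
    moreover have "2 * \<delta> \<le> \<epsilon> - d i T" using \<delta>[OF that(2)] by simp
    ultimately show ?thesis using le[OF that(2), of S] by linarith
  qed
  then have "?W \<subseteq> {S \<in> Borel_aut M. \<forall>i\<in>I. d i S < \<epsilon>}" by auto
  ultimately show ?thesis by (rule bexI[rotated])
qed

text \<open>Containing a tau-neighborhood of \<open>T\<close> passes to finite intersections and to
  unions, so it is enough to test it on generators.\<close>

lemma openin_contains_tau_nbhd:
  assumes "openin (topology_generated_by \<S>) V" "T \<in> V"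
    and "\<And>V. V \<in> \<S> \<Longrightarrow> T \<in> V \<Longrightarrow> \<exists>W\<in>tau_nbhds M T. W \<subseteq> V"
  shows "\<exists>W\<in>tau_nbhds M T. W \<subseteq> V"
proof -
  have "generate_topology_on \<S> V" using assms(1) by (rule openin_topology_generated_by)
  then show ?thesis using assms(2)
  proof induction
    case (Int a b)
    then obtain W1 W2 where "W1 \<in> tau_nbhds M T" "W1 \<subseteq> a" "W2 \<in> tau_nbhds M T" "W2 \<subseteq> b"
      by auto
    moreover obtain W where "W \<in> tau_nbhds M T" "W \<subseteq> W1 \<inter> W2"
      using tau_nbhds_Int[OF calculation(1,3)] ..
    ultimately show ?case by (intro bexI[of _ W]) auto
  next
    case (UN K)
    then obtain k where k: "k \<in> K" "T \<in> k" by auto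
    obtain W where "W \<in> tau_nbhds M T" "W \<subseteq> k" using UN.IH[OF k] ..
    then show ?case using k(1) by (intro bexI[of _ W]) auto
  qed (use assms(3) in auto)
qed

text \<open>Phrased for neighborhoods so that one closure argument serves three topologies. The
  point \<open>T\<close> may differ from the centre \<open>T0\<close>, since the generators
  containing \<open>T\<close> have arbitrary centres. Membership of \<open>Borel_aut M\<close> among
  the neighborhoods makes it the underlying set of the topology.\<close>

definition coarser_than_tau :: "'a measure \<Rightarrow> (('a \<Rightarrow> 'a) \<Rightarrow> ('a \<Rightarrow> 'a) set set) \<Rightarrow> bool" where
  "coarser_than_tau M nbhds_of \<longleftrightarrow>
     (\<forall>T0\<in>Borel_aut M. Borel_aut M \<in> nbhds_of T0 \<and>
       (\<forall>V\<in>nbhds_of T0. V \<subseteq> Borel_aut M \<and> (\<forall>T\<in>V. \<exists>W\<in>tau_nbhds M T. W \<subseteq> V)))"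

text \<open>An open set around \<open>T\<close> contains a tau-neighborhood of \<open>T\<close>,
  which meets \<open>D\<close>. The pointwise form serves the full group, where approximants are
  sought only for its own elements.\<close>

lemma coarser_than_tau_closure:
  assumes coarser: "coarser_than_tau M nbhds_of"
  defines "X \<equiv> topology_generated_by (\<Union>T\<in>Borel_aut M. nbhds_of T)"
  shows in_closure_of_if_meets_tau_nbhds:
      "T \<in> Borel_aut M \<Longrightarrow> (\<And>W. W \<in> tau_nbhds M T \<Longrightarrow> D \<inter> W \<noteq> {}) \<Longrightarrow> T \<in> X closure_of D"
    and closure_of_eq_if_meets_tau_nbhds:
      "(\<And>T W. T \<in> Borel_aut M \<Longrightarrow> W \<in> tau_nbhds M T \<Longrightarrow> D \<inter> W \<noteq> {}) \<Longrightarrow>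
        X closure_of D = Borel_aut M"
proof -
  have nbhd: "Borel_aut M \<in> nbhds_of T0" "V \<in> nbhds_of T0 \<Longrightarrow> V \<subseteq> Borel_aut M"
    "V \<in> nbhds_of T0 \<Longrightarrow> T \<in> V \<Longrightarrow> \<exists>W\<in>tau_nbhds M T. W \<subseteq> V"
    if "T0 \<in> Borel_aut M" for T0 T V
    using coarser that unfolding coarser_than_tau_def by blast+
  have top: "topspace X = Borel_aut M"
    unfolding X_def topology_generated_by_topspace using nbhd(1,2) id_Borel_aut[of M] by blast
  have closure: "T \<in> X closure_of D"
    if T: "T \<in> Borel_aut M" and D: "\<And>W. W \<in> tau_nbhds M T \<Longrightarrow> D \<inter> W \<noteq> {}" for T
    unfolding in_closure_of top
  proof (intro conjI T allI impI)
    fix V assume V: "T \<in> V \<and> openin X V"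
    have "\<exists>W\<in>tau_nbhds M T. W \<subseteq> V"
    proof (rule openin_contains_tau_nbhd)
      show "openin (topology_generated_by (\<Union>T\<in>Borel_aut M. nbhds_of T)) V"
        using V by (simp add: X_def)
      show "\<exists>W\<in>tau_nbhds M T. W \<subseteq> V'"
        if "V' \<in> (\<Union>T\<in>Borel_aut M. nbhds_of T)" and TV: "T \<in> V'" for V'
      proof -
        obtain T0 where "T0 \<in> Borel_aut M" "V' \<in> nbhds_of T0"
          using \<open>V' \<in> (\<Union>T\<in>Borel_aut M. nbhds_of T)\<close> by (rule UN_E)
        then show ?thesis using nbhd(3) TV by simp
      qed
    qed (use V in simp)
    then obtain W where W: "W \<in> tau_nbhds M T" "W \<subseteq> V" ..
    then have "D \<inter> V \<noteq> {}" using D[OF W(1)] by auto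
    then show "\<exists>y. y \<in> D \<and> y \<in> V" by auto
  qed
  then show "T \<in> Borel_aut M \<Longrightarrow> (\<And>W. W \<in> tau_nbhds M T \<Longrightarrow> D \<inter> W \<noteq> {}) \<Longrightarrow> T \<in> X closure_of D"
    by simp
  assume "\<And>T W. T \<in> Borel_aut M \<Longrightarrow> W \<in> tau_nbhds M T \<Longrightarrow> D \<inter> W \<noteq> {}"
  then have "Borel_aut M \<subseteq> X closure_of D" using closure by (intro subsetI) simp
  then show "X closure_of D = Borel_aut M"
    using closure_of_subset_topspace[of X D] top by simp
qed

section \<open>Orbits and the full group\<close>

text \<open>Natural powers on both sides replace an integer power. In this form orbit equivalence is
  visibly symmetric, and transitivity amounts to adding exponents.\<close>

lemma int_orbit_iff:
  assumes "bij T"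
  shows "y \<in> int_orbit T x \<longleftrightarrow> (\<exists>i j. (T ^^ i) y = (T ^^ j) x)"
proof
  have cancel: "(inv T ^^ i) ((T ^^ i) z) = z" "(T ^^ i) ((inv T ^^ i) z) = z" for i z
    using funpow_inverse_cancel[of "inv T" T] funpow_inverse_cancel[of T "inv T"] assms
    by (auto simp: bij_is_inj bij_is_surj surj_f_inv_f)
  assume "y \<in> int_orbit T x"
  then obtain n where "y = int_iter T n x" by (auto simp: int_orbit_def)
  then have "y = (T ^^ nat n) x \<or> (T ^^ nat (- n)) y = x"
    by (auto simp: int_iter_def cancel split: if_splits)
  then show "\<exists>i j. (T ^^ i) y = (T ^^ j) x" by (metis funpow_0)
next
  have cancel: "(inv T ^^ i) ((T ^^ i) z) = z" for i z
    using funpow_inverse_cancel[of "inv T" T] assms by (auto simp: bij_is_inj)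
  assume "\<exists>i j. (T ^^ i) y = (T ^^ j) x"
  then obtain i j where ij: "(T ^^ i) y = (T ^^ j) x" by (elim exE)
  have split: "(T ^^ (k - l)) z = (inv T ^^ l) ((T ^^ k) z)" if "l \<le> k" for k l z
    by (simp add: funpow_split[OF that, of T] cancel)
  have iter: "(T ^^ n) z \<in> int_orbit T z" "(inv T ^^ n) z \<in> int_orbit T z" for n z
  proof -
    have "(T ^^ n) z = int_iter T (int n) z" "(inv T ^^ n) z = int_iter T (- int n) z"
      by (simp_all add: int_iter_def)
    then show "(T ^^ n) z \<in> int_orbit T z" "(inv T ^^ n) z \<in> int_orbit T z"
      unfolding int_orbit_def by blast+
  qed
  show "y \<in> int_orbit T x"
  proof (cases "i \<le> j")
    case True
    then have "y = (T ^^ (j - i)) x" using split[of i j x] by (simp add: ij[symmetric] cancel)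
    then show ?thesis by (simp add: iter)
  next
    case False
    then have "(T ^^ (i - j)) y = x" using split[of j i y] by (simp add: ij cancel)
    then have "y = (inv T ^^ (i - j)) x" using cancel[of "i - j" y] by simp
    then show ?thesis by (simp add: iter)
  qed
qed

text \<open>Lying on a common \<open>T\<close>-orbit is an equivalence relation. Since
  \<open>\<gamma>\<close> moves points within its classes, so does any map that stays inside the
  orbits of \<open>\<gamma>\<close>.\<close>

lemma full_group_trans:
  assumes T: "T \<in> Borel_aut M" and \<gamma>: "\<gamma> \<in> full_group M T" and P: "P \<in> Borel_aut M"
    and orbit: "\<And>x. \<exists>i j. (\<gamma> ^^ i) (P x) = (\<gamma> ^^ j) x"
  shows "P \<in> full_group M T"
proof -
  define R where "R x y \<longleftrightarrow> (\<exists>i j. (T ^^ i) x = (T ^^ j) y)" for x y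
  have R_refl: "R x x" for x by (auto simp: R_def)
  have R_sym: "R y x" if "R x y" for x y using that unfolding R_def by metis
  have R_trans: "R x z" if R: "R x y" "R y z" for x y z
  proof -
    obtain i j k l where 1: "(T ^^ i) x = (T ^^ j) y" and 2: "(T ^^ k) y = (T ^^ l) z"
      using R unfolding R_def by blast
    have "(T ^^ (k + i)) x = (T ^^ k) ((T ^^ j) y)" by (simp add: funpow_add 1)
    also have "\<dots> = (T ^^ j) ((T ^^ k) y)" by (rule funpow_commute)
    also have "\<dots> = (T ^^ (j + l)) z" by (simp add: funpow_add 2)
    finally show ?thesis unfolding R_def by blast
  qed
  have orbit_R: "y \<in> int_orbit T x \<longleftrightarrow> R y x" for x y
    unfolding R_def by (rule int_orbit_iff[OF Borel_autD(4)[OF T]])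
  have \<gamma>_aut: "\<gamma> \<in> Borel_aut M" using \<gamma> by (simp add: full_group_def)
  have R\<gamma>: "R (\<gamma> x) x" for x
  proof (cases "x \<in> space M")
    case True
    then show ?thesis using \<gamma> orbit_R by (auto simp: full_group_def)
  next
    case False
    then show ?thesis using permutes_not_in[OF Borel_autD(1)[OF \<gamma>_aut]] R_refl by metis
  qed
  have "R ((\<gamma> ^^ n) x) x" for n x
    by (induction n) (auto intro: R_refl R_trans R\<gamma>)
  then have "R (P x) x" for x using orbit[of x] R_sym R_trans by metis
  then show ?thesis using P orbit_R by (simp add: full_group_def)
qed

section \<open>Comparison of tau'' and p-bar with tau\<close>

lemma diff_set_triangle: "diff_set M S T0 \<subseteq> diff_set M S T \<union> diff_set M T T0"
  by (auto simp: diff_set_def)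

text \<open>As preimages under the inverse, images become measurable, and two of them can differ
  only where the inverse maps differ.\<close>

lemma image_eq_inv_vimage:
  assumes "S \<in> Borel_aut M" "F \<subseteq> space M"
  shows "S ` F = inv S -` F \<inter> space M" "inv S ` F = S -` F \<inter> space M"
proof -
  note S = Borel_autD[OF assms(1)]
  show "S ` F = inv S -` F \<inter> space M"
    using S(5,6,7) assms(2) by (auto intro: rev_image_eqI)
  show "inv S ` F = S -` F \<inter> space M"
    using S(5,6,8) assms(2) by (auto intro: rev_image_eqI)
qed

lemma image_measurable:
  assumes "S \<in> Borel_aut M" "F \<in> sets M"
  shows "S ` F \<in> sets M" "inv S ` F \<in> sets M"
  using image_eq_inv_vimage[OF assms(1) sets.sets_into_space[OF assms(2)]]
    measurable_sets[OF Borel_autD(3)[OF assms(1)] assms(2)]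
    measurable_sets[OF Borel_autD(2)[OF assms(1)] assms(2)] by auto

text \<open>The integrands agree where \<open>inv S\<close> and \<open>inv T\<close> agree, and
  elsewhere they differ by at most 2.\<close>

lemma push_integral_diff_le:
  assumes sb: "standard_borel M" and \<mu>: "\<mu> \<in> Borel_probs M"
    and S: "S \<in> Borel_aut M" and T: "T \<in> Borel_aut M" and f: "f \<in> Borel_unit_ball M"
  shows "\<bar>push_integral \<mu> S f - push_integral \<mu> T f\<bar> \<le> 2 * measure \<mu> (diff_set M S T)"
proof -
  interpret prob_space \<mu> using \<mu> by (simp add: Borel_probs_def)
  have sets_eq [measurable_cong, simp]: "sets \<mu> = sets M" using \<mu> by (simp add: Borel_probs_def)
  have space_eq [simp]: "space \<mu> = space M" by (rule sets_eq_imp_space_eq) simp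
  have [measurable]: "f \<in> borel_measurable M" and f1: "\<And>x. x \<in> space M \<Longrightarrow> \<bar>f x\<bar> \<le> 1"
    using f by (auto simp: Borel_unit_ball_def)
  have int: "integrable \<mu> (\<lambda>x. f (inv R x))" if R: "R \<in> Borel_aut M" for R
  proof (rule integrable_const_bound[where B = 1])
    note [measurable] = Borel_autD(3)[OF R]
    show "(\<lambda>x. f (inv R x)) \<in> borel_measurable \<mu>" by measurable
    show "AE x in \<mu>. norm (f (inv R x)) \<le> 1"
      using f1 Borel_autD(8)[OF R] by (auto intro!: AE_I2)
  qed
  let ?E = "diff_set M S T"
  have E [measurable]: "?E \<in> sets M" using diff_set_measurable[OF sb S T] .
  have intE: "integrable \<mu> (\<lambda>x. 2 * indicator ?E x :: real)"
    by (intro integrable_mult_right integrable_real_indicator) (auto simp: emeasure_eq_measure)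
  have "\<bar>push_integral \<mu> S f - push_integral \<mu> T f\<bar> = \<bar>\<integral>x. f (inv S x) - f (inv T x) \<partial>\<mu>\<bar>"
    using int[OF S] int[OF T] by (simp add: push_integral_def)
  also have "\<dots> \<le> (\<integral>x. \<bar>f (inv S x) - f (inv T x)\<bar> \<partial>\<mu>)"
    by (rule integral_abs_bound)
  also have "\<dots> \<le> (\<integral>x. 2 * indicator ?E x \<partial>\<mu>)"
  proof (rule integral_mono)
    fix x assume x: "x \<in> space \<mu>"
    have "\<bar>f (inv S x) - f (inv T x)\<bar> \<le> 2"
      using f1[of "inv S x"] f1[of "inv T x"] x Borel_autD(8)[OF S] Borel_autD(8)[OF T] by auto
    then show "\<bar>f (inv S x) - f (inv T x)\<bar> \<le> 2 * indicator ?E x"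
      using x by (auto simp: indicator_def diff_set_def)
  qed (use int[OF S] int[OF T] intE in auto)
  also have "\<dots> = 2 * measure \<mu> ?E" by simp
  finally show "\<bar>push_integral \<mu> S f - push_integral \<mu> T f\<bar> \<le> 2 * measure \<mu> ?E" .
qed

text \<open>Not a tautology: neighborhoods centred at \<open>T0\<close> must contain neighborhoods
  centred at their other points. This is the triangle inequality for the measures of difference
  sets.\<close>

lemma coarser_than_tau_tau:
  assumes sb: "standard_borel M"
  shows "coarser_than_tau M (tau_nbhds M)"
  unfolding coarser_than_tau_def
proof (intro ballI conjI)
  show "Borel_aut M \<in> tau_nbhds M T0" for T0
    unfolding tau_nbhds_def by (intro CollectI exI[of _ "{}"] exI[of _ 1]) auto
  show sub: "V \<subseteq> Borel_aut M" if "V \<in> tau_nbhds M T0" for T0 V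
    using that by (auto simp: tau_nbhds_def)
  show "\<exists>W\<in>tau_nbhds M T. W \<subseteq> V"
    if T0: "T0 \<in> Borel_aut M" and V: "V \<in> tau_nbhds M T0" "T \<in> V" for T0 V T
  proof -
    have T: "T \<in> Borel_aut M" using sub[OF V(1)] V(2) by (rule subsetD)
    obtain \<M> \<epsilon> where V_eq: "V = {S \<in> Borel_aut M. \<forall>\<mu>\<in>\<M>. measure \<mu> (diff_set M S T0) < \<epsilon>}"
      and \<M>: "finite \<M>" "\<M> \<subseteq> Borel_probs M"
      using V(1) by (auto simp: tau_nbhds_def)
    show ?thesis unfolding V_eq
    proof (rule tau_nbhd_sublevel[where m = "\<lambda>\<mu>. \<mu>"])
      fix \<mu> S assume \<mu>: "\<mu> \<in> \<M>" and S: "S \<in> Borel_aut M"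
      interpret prob_space \<mu> using \<mu> \<M> by (auto simp: Borel_probs_def)
      have [simp]: "sets \<mu> = sets M" using \<mu> \<M> by (auto simp: Borel_probs_def)
      note E = diff_set_measurable[OF sb]
      have "measure \<mu> (diff_set M S T0) \<le> measure \<mu> (diff_set M S T \<union> diff_set M T T0)"
        using E S T T0 by (intro finite_measure_mono diff_set_triangle) auto
      also have "\<dots> \<le> measure \<mu> (diff_set M S T) + measure \<mu> (diff_set M T T0)"
        using E S T T0 by (intro measure_Un_le) auto
      finally show "measure \<mu> (diff_set M S T0)
          \<le> measure \<mu> (diff_set M T T0) + 2 * measure \<mu> (diff_set M S T)"
        using measure_nonneg[of \<mu> "diff_set M S T"] by linarith
    qed (use \<M> V(2) V_eq in auto)
  qed
qed

lemma coarser_than_tau_tau2: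
  assumes sb: "standard_borel M"
  shows "coarser_than_tau M (tau2_nbhds M)"
  unfolding coarser_than_tau_def
proof (intro ballI conjI)
  show "Borel_aut M \<in> tau2_nbhds M T0" for T0
    unfolding tau2_nbhds_def by (intro CollectI exI[of _ "{}"] exI[of _ 1]) auto
  show sub: "V \<subseteq> Borel_aut M" if "V \<in> tau2_nbhds M T0" for T0 V
    using that by (auto simp: tau2_nbhds_def)
  show "\<exists>W\<in>tau_nbhds M T. W \<subseteq> V"
    if T0: "T0 \<in> Borel_aut M" and V: "V \<in> tau2_nbhds M T0" "T \<in> V" for T0 V T
  proof -
    have T: "T \<in> Borel_aut M" using sub[OF V(1)] V(2) by (rule subsetD)
    define d where "d \<mu> S =
      (SUP f\<in>Borel_unit_ball M. \<bar>push_integral \<mu> S f - push_integral \<mu> T0 f\<bar>)" for \<mu> S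
    obtain \<M> \<epsilon> where V_eq: "V = {S \<in> Borel_aut M. \<forall>\<mu>\<in>\<M>. d \<mu> S < \<epsilon>}"
      and \<M>: "finite \<M>" "\<M> \<subseteq> Borel_probs M"
      using V(1) by (auto simp: tau2_nbhds_def d_def)
    show ?thesis unfolding V_eq
    proof (rule tau_nbhd_sublevel[where m = "\<lambda>\<mu>. \<mu>"])
      fix \<mu> S assume "\<mu> \<in> \<M>" and S: "S \<in> Borel_aut M"
      then have \<mu>: "\<mu> \<in> Borel_probs M" using \<M> by auto
      note bound = push_integral_diff_le[OF sb \<mu>]
      \<comment> \<open>The real supremum bounds its members only if they are bounded above; the
        integral estimate supplies a bound uniform in \<open>f\<close>.\<close>
      have bdd: "bdd_above ((\<lambda>f. \<bar>push_integral \<mu> T f - push_integral \<mu> T0 f\<bar>) ` Borel_unit_ball M)"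
        using bound[OF T T0] by (intro bdd_aboveI2)
      show "d \<mu> S \<le> d \<mu> T + 2 * measure \<mu> (diff_set M S T)"
        unfolding d_def[of \<mu> S]
      proof (rule cSUP_least)
        have "(\<lambda>_. 0) \<in> Borel_unit_ball M" by (auto simp: Borel_unit_ball_def)
        then show "Borel_unit_ball M \<noteq> {}" by blast
        fix f assume f: "f \<in> Borel_unit_ball M"
        have "\<bar>push_integral \<mu> T f - push_integral \<mu> T0 f\<bar> \<le> d \<mu> T"
          unfolding d_def using f bdd by (rule cSUP_upper)
        then show "\<bar>push_integral \<mu> S f - push_integral \<mu> T0 f\<bar>
            \<le> d \<mu> T + 2 * measure \<mu> (diff_set M S T)"
          using bound[OF S T f] by linarith
      qed
    qed (use \<M> V(2) V_eq in auto)
  qed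
qed

lemma coarser_than_tau_p_bar:
  assumes sb: "standard_borel M"
  shows "coarser_than_tau M (p_bar_nbhds M)"
  unfolding coarser_than_tau_def
proof (intro ballI conjI)
  show "Borel_aut M \<in> p_bar_nbhds M T0" for T0
    unfolding p_bar_nbhds_def by (intro CollectI exI[of _ "{}"] exI[of _ 1]) auto
  show sub: "V \<subseteq> Borel_aut M" if "V \<in> p_bar_nbhds M T0" for T0 V
    using that by (auto simp: p_bar_nbhds_def)
  show "\<exists>W\<in>tau_nbhds M T. W \<subseteq> V"
    if T0: "T0 \<in> Borel_aut M" and V: "V \<in> p_bar_nbhds M T0" "T \<in> V" for T0 V T
  proof -
    have T: "T \<in> Borel_aut M" using sub[OF V(1)] V(2) by (rule subsetD)
    \<comment> \<open>Indexing by pairs of a set and a measure turns the double quantifier into the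
      single family of the sublevel criterion.\<close>
    define d where "d i S = measure (snd i) (sym_diff (S ` fst i) (T0 ` fst i)) +
      measure (snd i) (sym_diff (inv S ` fst i) (inv T0 ` fst i))" for i and S :: "'a \<Rightarrow> 'a"
    obtain \<F> \<M> \<epsilon> where "V = {S \<in> Borel_aut M. \<forall>F\<in>\<F>. \<forall>\<mu>\<in>\<M>. d (F, \<mu>) S < \<epsilon>}"
      and \<F>: "finite \<F>" "\<F> \<subseteq> sets M" and \<M>: "finite \<M>" "\<M> \<subseteq> Borel_probs M"
      using V(1) unfolding p_bar_nbhds_def d_def fst_conv snd_conv mem_Collect_eq by (elim exE conjE)
    then have V_eq: "V = {S \<in> Borel_aut M. \<forall>i\<in>\<F> \<times> \<M>. d i S < \<epsilon>}" by simp
    show ?thesis unfolding V_eq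
    proof (rule tau_nbhd_sublevel[where m = snd])
      fix i S assume i: "i \<in> \<F> \<times> \<M>" and S: "S \<in> Borel_aut M"
      obtain F \<mu> where i_eq: "i = (F, \<mu>)" and F: "F \<in> sets M" and \<mu>: "\<mu> \<in> Borel_probs M"
        using i \<F> \<M> by auto
      interpret prob_space \<mu> using \<mu> by (simp add: Borel_probs_def)
      have [simp]: "sets \<mu> = sets M" using \<mu> by (simp add: Borel_probs_def)
      have E: "diff_set M S T \<in> sets M" by (rule diff_set_measurable[OF sb S T])
      have step: "measure \<mu> (sym_diff A C) \<le> measure \<mu> (sym_diff B C) + measure \<mu> (diff_set M S T)"
        if "A \<in> sets M" "B \<in> sets M" "C \<in> sets M" "sym_diff A B \<subseteq> diff_set M S T" for A B C
      proof -
        have "measure \<mu> (sym_diff A C) \<le> measure \<mu> (sym_diff B C \<union> diff_set M S T)"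
          using that E by (intro finite_measure_mono) auto
        also have "\<dots> \<le> measure \<mu> (sym_diff B C) + measure \<mu> (diff_set M S T)"
          using that E by (intro measure_Un_le) auto
        finally show ?thesis .
      qed
      \<comment> \<open>Images under \<open>S\<close> and \<open>T\<close> differ only where the
        inverses differ, and images under the inverses only where \<open>S\<close> and
        \<open>T\<close> differ. \<open>diff_set\<close> covers both, so each of the two terms
        changes by at most its measure.\<close>
      have "sym_diff (S ` F) (T ` F) \<subseteq> diff_set M S T"
        "sym_diff (inv S ` F) (inv T ` F) \<subseteq> diff_set M S T"
        using image_eq_inv_vimage[OF _ sets.sets_into_space[OF F]] S T
        by (auto simp: diff_set_def)
      then show "d i S \<le> d i T + 2 * measure (snd i) (diff_set M S T)"
        unfolding d_def i_eq fst_conv snd_conv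
        using step[of "S ` F" "T ` F" "T0 ` F"] step[of "inv S ` F" "inv T ` F" "inv T0 ` F"]
          image_measurable[OF S F] image_measurable[OF T F] image_measurable[OF T0 F] by simp
    qed (use \<F> \<M> V(2) V_eq in auto)
  qed
qed

section \<open>A shift that no periodic map imitates on a set\<close>

lemma singleton_measurable:
  assumes "standard_borel M" "x \<in> space M"
  shows "{x} \<in> sets M"
proof -
  obtain U :: "nat \<Rightarrow> 'a set" where U [measurable]: "\<And>n. U n \<in> sets M"
    and sep: "\<And>x D. x \<in> space M \<Longrightarrow> finite D \<Longrightarrow> x \<notin> D \<Longrightarrow> \<exists>n. x \<in> U n \<and> U n \<inter> D = {}"
    using standard_borel_countable_base[OF assms(1)] by blast
  have "{x} = {y \<in> space M. \<forall>n. x \<in> U n \<longrightarrow> y \<in> U n}"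
    using sep[of x "{_}"] assms(2) by fastforce
  also have "\<dots> \<in> sets M" by measurable
  finally show ?thesis .
qed

text \<open>A preimage of \<open>A\<close> is \<open>A - C\<close> up to a subset of
  \<open>C\<close>, and every subset of the countable set \<open>C\<close> is measurable because
  singletons are.\<close>

lemma countable_modification_measurable:
  assumes sb: "standard_borel M" and C: "countable C" "C \<subseteq> space M"
    and f: "\<And>x. x \<in> C \<Longrightarrow> f x \<in> space M" "\<And>x. x \<notin> C \<Longrightarrow> f x = x"
  shows "f \<in> measurable M M"
proof (rule measurableI)
  show "f x \<in> space M" if "x \<in> space M" for x using f that by (cases "x \<in> C") auto
  have countable: "B \<in> sets M" if "B \<subseteq> C" for B
  proof (rule sets.countable)
    show "countable B" by (rule countable_subset[OF that C(1)])
    show "{b} \<in> sets M" if "b \<in> B" for b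
      using singleton_measurable[OF sb] that \<open>B \<subseteq> C\<close> C(2) by blast
  qed
  show "f -` A \<inter> space M \<in> sets M" if A: "A \<in> sets M" for A
  proof -
    have "f -` A \<inter> space M = (A - C) \<union> (f -` A \<inter> C)"
    proof (intro set_eqI)
      show "x \<in> f -` A \<inter> space M \<longleftrightarrow> x \<in> (A - C) \<union> (f -` A \<inter> C)" for x
        using f(2)[of x] C(2) sets.sets_into_space[OF A] by (cases "x \<in> C") auto
    qed
    then show ?thesis using A countable[of C] countable[of "f -` A \<inter> C"] by auto
  qed
qed

text \<open>A two-sided shift along a copy of the integers is invertible, yet it maps the
  nonnegative half properly into itself.\<close>

lemma exists_shrinking_aut:
  assumes sb: "standard_borel M" and "infinite (space M)"
  obtains T F where "T \<in> Borel_aut M" "F \<in> sets M" "T ` F \<subset> F"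
proof -
  obtain e :: "nat \<Rightarrow> 'a" where e: "inj e" "range e \<subseteq> space M"
    using infinite_countable_subset[OF assms(2)] by blast
  define c :: "int \<Rightarrow> 'a" where "c = e \<circ> to_nat"
  have c: "inj c" "range c \<subseteq> space M"
    using e by (auto simp: c_def intro: inj_compose)
  \<comment> \<open>All shift lengths are treated together, so that \<open>shift (- 1)\<close> is
    available as the inverse and measurability is shown once for both.\<close>
  define shift where "shift k x = (if x \<in> range c then c (inv c x + k) else x)" for k x
  have shift_c: "shift k (c n) = c (n + k)" for k n
    using c(1) by (simp add: shift_def)
  have shift_out: "shift k x = x" if "x \<notin> range c" for k x
    using that by (simp add: shift_def)
  have cancel: "shift k (shift l x) = x" if "k + l = 0" for k l x
  proof (cases "x \<in> range c")
    case True
    then show ?thesis using that by (auto simp: shift_c algebra_simps)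
  qed (simp add: shift_out)
  have meas: "shift k \<in> measurable M M" for k
    using c(2) shift_c shift_out
    by (intro countable_modification_measurable[OF sb, of "range c"]) auto
  have "bij (shift 1)"
    by (rule o_bij[of "shift (- 1)"]) (auto simp: cancel)
  moreover have "shift 1 x = x" if "x \<notin> space M" for x
    using that c(2) by (intro shift_out) auto
  ultimately have "shift 1 permutes space M"
    by (auto simp: permutes_def bij_iff)
  moreover have "inv (shift 1) = shift (- 1)"
    by (rule inv_unique_comp) (auto simp: cancel)
  ultimately have "shift 1 \<in> Borel_aut M"
    using meas by (simp add: Borel_aut_def)
  moreover have "c ` {0..} \<in> sets M"
  proof (rule sets.countable)
    show "{a} \<in> sets M" if "a \<in> c ` {0..}" for a
      using singleton_measurable[OF sb] that c(2) by blast
  qed simp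
  moreover have "shift 1 ` c ` {0..} \<subset> c ` {0..}"
  proof
    show "shift 1 ` c ` {0..} \<subseteq> c ` {0..}" by (auto simp: shift_c)
    have "c 0 \<notin> shift 1 ` c ` {0..}" using inj_eq[OF c(1)] by (auto simp: shift_c)
    then show "shift 1 ` c ` {0..} \<noteq> c ` {0..}" by auto
  qed
  ultimately show thesis by (rule that)
qed

text \<open>A point of \<open>F\<close> with period \<open>n\<close> is the image of
  \<open>(P ^^ (n - 1)) x\<close>, which is still in \<open>F\<close>. The period may vary with the
  point.\<close>

lemma Per_not_shrinking:
  assumes P: "P \<in> Per M" and F: "F \<subseteq> space M" "P ` F \<subseteq> F"
  shows "P ` F = F"
proof
  show "F \<subseteq> P ` F"
  proof
    fix x assume x: "x \<in> F"
    then obtain n where n: "n \<ge> 1" "(P ^^ n) x = x" using P F(1) by (auto simp: Per_def)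
    have "(P ^^ k) x \<in> F" for k by (induction k) (use x F(2) in auto)
    moreover have "x = P ((P ^^ (n - 1)) x)" using n by (cases n) auto
    ultimately show "x \<in> P ` F" by blast
  qed
qed fact

section \<open>Density and failure of density\<close>

lemma Per0_subset_Per: "Per0 M \<subseteq> Per M"
  by (auto simp: Per0_def Per_def)

lemma tau_nbhd_periodic:
  assumes sb: "standard_borel M" and T: "T \<in> Borel_aut M" and W: "W \<in> tau_nbhds M T"
  obtains P where "P \<in> Per0 M" "P \<in> W" "\<And>x. \<exists>i j. (T ^^ i) (P x) = (T ^^ j) x"
proof -
  obtain \<M> \<epsilon> where W_eq: "W = {S \<in> Borel_aut M. \<forall>\<mu>\<in>\<M>. measure \<mu> (diff_set M S T) < \<epsilon>}"
    and \<M>: "finite \<M>" "\<M> \<subseteq> Borel_probs M" and "0 < \<epsilon>"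
    using W by (auto simp: tau_nbhds_def)
  show thesis
  proof (rule periodic_approximation[OF sb T \<M> \<open>0 < \<epsilon>\<close>])
    fix P assume P: "P \<in> Per0 M" "\<And>x. \<exists>i j. (T ^^ i) (P x) = (T ^^ j) x"
      "\<And>\<mu>. \<mu> \<in> \<M> \<Longrightarrow> measure \<mu> (diff_set M P T) < \<epsilon>"
    have "P \<in> W" using P(1,3) by (simp add: W_eq Per0_def)
    then show thesis using P(1,2) that by simp
  qed
qed

lemma Per0_meets_tau_nbhds:
  assumes "standard_borel M" "T \<in> Borel_aut M" "W \<in> tau_nbhds M T"
  shows "Per0 M \<inter> W \<noteq> {}"
proof -
  obtain P where "P \<in> Per0 M" "P \<in> W" by (rule tau_nbhd_periodic[OF assms])
  then show ?thesis by auto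
qed

lemma Per_meets_tau_nbhds:
  assumes "standard_borel M" "T \<in> Borel_aut M" "W \<in> tau_nbhds M T"
  shows "Per M \<inter> W \<noteq> {}"
  using Per0_meets_tau_nbhds[OF assms] Per0_subset_Per[of M] by auto

text \<open>The approximation is applied to the element \<open>\<gamma>\<close> rather than to
  \<open>T\<close>. The periodic map obtained stays in the orbits of \<open>\<gamma>\<close>, hence
  in those of \<open>T\<close>.\<close>

lemma tau_closure_Per_full_group:
  assumes sb: "standard_borel M" and T: "T \<in> Borel_aut M"
  shows "subtopology (tau_top M) (full_group M T) closure_of (Per M \<inter> full_group M T)
      = full_group M T"
proof -
  have "\<gamma> \<in> tau_top M closure_of (Per M \<inter> full_group M T)" if \<gamma>: "\<gamma> \<in> full_group M T" for \<gamma>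
    unfolding tau_top_def
  proof (rule in_closure_of_if_meets_tau_nbhds[OF coarser_than_tau_tau[OF sb]])
    show \<gamma>_aut: "\<gamma> \<in> Borel_aut M" using \<gamma> by (simp add: full_group_def)
    fix W assume "W \<in> tau_nbhds M \<gamma>"
    with sb \<gamma>_aut obtain P where P: "P \<in> Per0 M" "P \<in> W"
      and orbit: "\<And>x. \<exists>i j. (\<gamma> ^^ i) (P x) = (\<gamma> ^^ j) x"
      by (rule tau_nbhd_periodic) (rule that, simp_all)
    have "P \<in> Borel_aut M" using P(1) by (simp add: Per0_def)
    then have "P \<in> full_group M T" using orbit by (rule full_group_trans[OF T \<gamma>])
    moreover have "P \<in> Per M" using P(1) Per0_subset_Per by (rule subsetD[rotated])
    ultimately show "Per M \<inter> full_group M T \<inter> W \<noteq> {}" using P(2) by auto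
  qed
  then have "full_group M T \<subseteq> tau_top M closure_of (Per M \<inter> full_group M T)"
    by (rule subsetI)
  moreover have "full_group M T \<inter> (Per M \<inter> full_group M T) = Per M \<inter> full_group M T"
    by auto
  ultimately show ?thesis by (simp add: closure_of_subtopology Int_absorb2)
qed

text \<open>One set \<open>F\<close> that \<open>T\<close> shrinks gives a basic neighborhood of
  \<open>T\<close> whose elements all shrink \<open>F\<close>, so it contains no periodic
  map.\<close>

lemma p_closure_Per:
  assumes sb: "standard_borel M" and "infinite (space M)"
  shows "p_top M closure_of Per M \<noteq> Borel_aut M"
proof -
  obtain T F where T: "T \<in> Borel_aut M" and F: "F \<in> sets M" "T ` F \<subset> F"
    by (rule exists_shrinking_aut[OF assms])
  let ?V = "{S \<in> Borel_aut M. \<forall>F'\<in>{F}. S ` F' = T ` F'}"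
  have "?V \<in> p_nbhds M T"
    unfolding p_nbhds_def using F(1) by (intro CollectI exI[of _ "{F}"]) auto
  then have V: "openin (p_top M) ?V"
    unfolding p_top_def using T by (intro topology_generated_by_Basis UN_I)
  have "P ` F \<noteq> T ` F" if "P \<in> Per M" for P
  proof
    assume eq: "P ` F = T ` F"
    with F(2) have "P ` F \<subset> F" by simp
    then show False
      using Per_not_shrinking[OF that sets.sets_into_space[OF F(1)]] by (simp add: psubset_eq)
  qed
  then have "?V \<inter> Per M = {}" by auto
  with openin_Int_closure_of_eq_empty[OF V] have "?V \<inter> p_top M closure_of Per M = {}"
    by (rule iffD2)
  then have "T \<notin> p_top M closure_of Per M" using T by auto
  with T show "p_top M closure_of Per M \<noteq> Borel_aut M" by auto
qed

theorem corollary2p8: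
  fixes M :: "'a measure"
  assumes "standard_borel M" and "uncountable (space M)"
  shows "(tau_top M closure_of Per M = Borel_aut M \<and>
          tau_top M closure_of Per0 M = Borel_aut M \<and>
          tau2_top M closure_of Per M = Borel_aut M \<and>
          p_bar_top M closure_of Per M = Borel_aut M) \<and>
         (\<forall>T\<in>Borel_aut M. aperiodic M T \<longrightarrow>
            subtopology (tau_top M) (full_group M T) closure_of (Per M \<inter> full_group M T)
              = full_group M T) \<and>
         p_top M closure_of Per M \<noteq> Borel_aut M"
proof (intro conjI ballI impI)
  note sb = assms(1)
  note meets = Per_meets_tau_nbhds[OF sb] and meets0 = Per0_meets_tau_nbhds[OF sb]
  show "tau_top M closure_of Per M = Borel_aut M"
    unfolding tau_top_def
    by (rule closure_of_eq_if_meets_tau_nbhds[OF coarser_than_tau_tau[OF sb] meets])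
  show "tau_top M closure_of Per0 M = Borel_aut M"
    unfolding tau_top_def
    by (rule closure_of_eq_if_meets_tau_nbhds[OF coarser_than_tau_tau[OF sb] meets0])
  show "tau2_top M closure_of Per M = Borel_aut M"
    unfolding tau2_top_def
    by (rule closure_of_eq_if_meets_tau_nbhds[OF coarser_than_tau_tau2[OF sb] meets])
  show "p_bar_top M closure_of Per M = Borel_aut M"
    unfolding p_bar_top_def
    by (rule closure_of_eq_if_meets_tau_nbhds[OF coarser_than_tau_p_bar[OF sb] meets])
  show "subtopology (tau_top M) (full_group M T) closure_of (Per M \<inter> full_group M T)
      = full_group M T" if "T \<in> Borel_aut M" for T
    by (rule tau_closure_Per_full_group[OF sb that])
  show "p_top M closure_of Per M \<noteq> Borel_aut M"
    by (rule p_closure_Per[OF sb uncountable_infinite[OF assms(2)]])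
qed

end
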